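(* Let $p$ be a prime, $p>3$, and let $q = p^h$ with $h \in \mathbb{N}$. Then for every sufficiently large $M_0 \in \mathbb{N}$ there exists a Sidon set $S = S(q, M_0)$ in $\mathbb{G}_{4M_0} \subseteq \mathbb{F}_q[t]$ such that, given any $g \in \mathbb{G}_{4M_0}$, there exist $s_1, s_2, s_3 \in S$ with $s_i \neq s_j$ for $i \neq j$ and $$s_1 + s_2 + s_3 = g.$$
   Context: For $N \in \mathbb{N}$, $\mathbb{G}_N = \{ f \in \mathbb{F}_q[t] : \deg f < N \}$, a group under addition (containing $0$). A subset $A$ of an abelian group $G$ is a Sidon set if for every $x \in G$ with $x \neq 0$ there is at most one pair $(a,a') \in A \times A$ with $x = a - a'$; equivalently, $a+b=c+d$ with $a,b,c,d \in A$ implies $\{a,b\}=\{c,d\}$ (that is, $a=c,b=d$ or $a=d,b=c$). *)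

theory Defs
  imports
    "HOL-Library.Cardinality"
    "HOL-Computational_Algebra.Primes"
    "HOL-Computational_Algebra.Polynomial"
begin

text \<open>The library has \<open>degree 0 = 0\<close>, whereas the convention here is that the zero
  polynomial has degree minus infinity, so that \<open>0\<close> lies in every \<open>poly_below N\<close>.\<close>

definition poly_below :: "nat \<Rightarrow> 'a::field poly set" where
  "poly_below N = {f. f = 0 \<or> degree f < N}"

text \<open>Here \<open>G\<close> is meant to be (the carrier of) a subgroup of the ambient type.\<close>

definition sidon_in :: "'a::ab_group_add set \<Rightarrow> 'a set \<Rightarrow> bool" where
  "sidon_in G A \<longleftrightarrow> A \<subseteq> G \<and>
     (\<forall>x\<in>G. x \<noteq> 0 \<longrightarrow> (\<exists>\<^sub>\<le>\<^sub>1 y. y \<in> A \<times> A \<and> x = fst y - snd y))"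

end

theory Submission
  imports
    "HOL-Number_Theory.Residues"
    "HOL-Algebra.Algebraic_Closure_Type"
    "HOL-Library.FuncSet"
    "HOL-Library.Product_Plus"
    Defs
begin

text \<open>
  As a vector space over the field with \<open>q\<close> elements, \<open>poly_below (4 * M)\<close> has dimension \<open>4 * M\<close>;
  hence it is additively isomorphic to \<open>F \<times> F\<close>, where \<open>F\<close> is the field with \<open>q ^ (2 * M)\<close>
  elements. Being a Sidon set and being a basis of order three are properties of the additive
  group, so it suffices to find such a set in \<open>F \<times> F\<close>. The parabola \<open>{(x, x\<^sup>2) | x. x \<in> F}\<close>
  works. It is a Sidon set in odd characteristic because \<open>x - y\<close> and \<open>x\<^sup>2 - y\<^sup>2\<close> determine
  \<open>x + y\<close>, unless \<open>x = y\<close>.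

  That sums of three distinct points of the parabola cover everything means that
  \<open>x + y + z = a\<close>, \<open>x\<^sup>2 + y\<^sup>2 + z\<^sup>2 = b\<close> is solvable in distinct \<open>x, y, z \<in> F\<close>. In the sum
  zero plane, \<open>x\<^sup>2 + y\<^sup>2 + z\<^sup>2\<close> is a binary quadratic form of discriminant \<open>-3\<close> up to
  squares. If it were anisotropic, the points with \<open>3 * b = a\<^sup>2\<close> would only be reached with
  \<open>x = y = z\<close>. It is isotropic exactly when \<open>F\<close> contains a primitive cube root \<open>w\<close> of unity;
  this is what the factor 4 is for, since \<open>q ^ (2 * M)\<close> is a square prime to 3 and
  hence \<open>1\<close> modulo 3. With \<open>w\<close> at hand, a discrete Fourier transform of length three turns the
  problem into prescribing one product \<open>\<beta> * \<gamma>\<close>; see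
  \<open>exists_distinct_prescribed_sum_and_square_sum\<close> and \<open>parabola_sidon_and_three_fold_basis\<close>.

  The field \<open>F\<close> depends on \<open>M\<close> and cannot be a type, so it is taken to be the set of fixed points of
  \<open>x \<mapsto> x ^ (q ^ (2 * M))\<close> in the algebraic closure
  (\<open>finite_subfield_power_fixed_points\<close>). The isomorphism comes from coordinates with respect to a
  basis of \<open>F\<close> over the ground field (\<open>poly_below_additive_bij\<close>).
\<close>

hide_const (open) Divisibility.prime

section \<open>Three points on a parabola over a field containing a primitive cube root of unity\<close>

lemma cube_eq_1_if_cyclotomic:
  fixes w :: "'k::comm_ring_1"
  assumes "w\<^sup>2 + w + 1 = 0"
  shows "w ^ 3 = 1"
proof -
  have "w ^ 3 - 1 = (w - 1) * (w\<^sup>2 + w + 1)"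
    by (simp add: algebra_simps power2_eq_square power3_eq_cube)
  with assms show ?thesis
    by simp
qed

locale finite_subfield =
  fixes F :: "'k::field set"
  assumes finite_F: "finite F"
    and one_F: "1 \<in> F"
    and diff_F: "x \<in> F \<Longrightarrow> y \<in> F \<Longrightarrow> x - y \<in> F"
    and mult_F: "x \<in> F \<Longrightarrow> y \<in> F \<Longrightarrow> x * y \<in> F"
    and inverse_F: "x \<in> F \<Longrightarrow> inverse x \<in> F"
begin

lemma zero_F: "0 \<in> F"
  using diff_F[OF one_F one_F] by simp

lemma add_F: "x \<in> F \<Longrightarrow> y \<in> F \<Longrightarrow> x + y \<in> F"
  using diff_F[of x "0 - y"] diff_F[OF zero_F, of y] by simp

lemma divide_F: "x \<in> F \<Longrightarrow> y \<in> F \<Longrightarrow> x / y \<in> F"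
  by (simp add: divide_inverse mult_F inverse_F)

lemma power_F: "x \<in> F \<Longrightarrow> x ^ n \<in> F"
  by (induction n) (auto intro: one_F mult_F)

lemma of_nat_F: "of_nat n \<in> F"
  by (induction n) (auto intro: zero_F one_F add_F)

lemma numeral_F: "numeral n \<in> F"
  using of_nat_F[of "numeral n"] by simp

lemmas closed_F = zero_F one_F add_F diff_F mult_F divide_F power_F numeral_F

text \<open>
  Substituting \<open>x = \<alpha> + \<beta> + \<gamma>\<close>, \<open>y = \<alpha> + w * \<beta> + w\<^sup>2 * \<gamma>\<close>, \<open>z = \<alpha> + w\<^sup>2 * \<beta> + w * \<gamma>\<close>
  turns the sum into \<open>3 * \<alpha>\<close> and the sum of squares into \<open>3 * \<alpha>\<^sup>2 + 6 * \<beta> * \<gamma>\<close>. So \<open>\<alpha>\<close> and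
  the product \<open>c = \<beta> * \<gamma>\<close> are forced, while \<open>\<beta> \<noteq> 0\<close> is free. Two of \<open>x, y, z\<close> coincide
  only if \<open>\<beta> / \<gamma>\<close> is a power of \<open>w\<close> or \<open>\<beta> = \<gamma> = 0\<close>, hence only if \<open>\<beta> ^ 3 = \<gamma> ^ 3\<close>, which for
  \<open>\<gamma> = c / \<beta>\<close> says \<open>\<beta> ^ 6 = c ^ 3\<close>. Together with \<open>0\<close> this excludes at most seven values of
  \<open>\<beta>\<close>, whence the bound on \<open>card F\<close>.
\<close>

lemma exists_distinct_prescribed_sum_and_square_sum:
  assumes two: "(2::'k) \<noteq> 0" and three: "(3::'k) \<noteq> 0"
    and w: "w \<in> F" "w\<^sup>2 + w + 1 = 0"
    and card: "card F > 7"
    and ab: "a \<in> F" "b \<in> F"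
  obtains x y z where "x \<in> F" "y \<in> F" "z \<in> F" "x \<noteq> y" "x \<noteq> z" "y \<noteq> z"
    "x + y + z = a" "x\<^sup>2 + y\<^sup>2 + z\<^sup>2 = b"
proof -
  have w3: "w ^ 3 = 1"
    using w(2) by (rule cube_eq_1_if_cyclotomic)
  have w_ne_1: "w \<noteq> 1"
    using w(2) three by auto
  have six: "(6::'k) \<noteq> 0"
    using no_zero_divisors[OF two three] by simp
  define \<alpha> where "\<alpha> = a / 3"
  define c where "c = (b - 3 * \<alpha>\<^sup>2) / 6"
  have six_c: "c * 6 = b - 3 * \<alpha>\<^sup>2"
    using six by (simp add: c_def)
  have \<alpha>: "\<alpha> \<in> F" and c: "c \<in> F"
    unfolding \<alpha>_def c_def using ab by (auto intro!: closed_F)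
  define P where "P = monom 1 6 - [:c ^ 3:]"
  have coeff_P: "coeff P 6 = 1"
    by (simp add: P_def coeff_pCons)
  then have "P \<noteq> 0"
    by auto
  have deg_P: "degree P \<le> 6"
    unfolding P_def by (intro degree_diff_le) (auto simp: degree_monom_eq)
  have "card (insert 0 {x. poly P x = 0}) \<le> Suc (card {x. poly P x = 0})"
    by (rule card_insert_le_m1) auto
  also have "\<dots> \<le> 7"
    using card_poly_roots_bound[OF \<open>P \<noteq> 0\<close>] deg_P by simp
  finally have "\<not> F \<subseteq> insert 0 {x. poly P x = 0}"
    using card card_mono[of "insert 0 {x. poly P x = 0}" F] poly_roots_finite[OF \<open>P \<noteq> 0\<close>]
    by force
  then obtain \<beta> where \<beta>: "\<beta> \<in> F" "\<beta> \<noteq> 0" "\<beta> ^ 6 \<noteq> c ^ 3"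
    by (auto simp: P_def poly_monom)
  define \<gamma> where "\<gamma> = c / \<beta>"
  have \<gamma>: "\<gamma> \<in> F"
    unfolding \<gamma>_def using \<beta> c by (auto intro!: closed_F)
  have prod_eq_c: "\<beta> * \<gamma> = c"
    using \<beta> by (simp add: \<gamma>_def)
  have cubes: "\<beta> ^ 3 \<noteq> \<gamma> ^ 3"
  proof
    assume "\<beta> ^ 3 = \<gamma> ^ 3"
    then have "\<beta> ^ 3 * \<beta> ^ 3 = \<beta> ^ 3 * \<gamma> ^ 3"
      by simp
    then have "\<beta> ^ 6 = c ^ 3"
      by (simp add: prod_eq_c[symmetric] power_mult_distrib flip: power_add)
    with \<beta> show False
      by simp
  qed
  define x y z where "x = \<alpha> + \<beta> + \<gamma>" and "y = \<alpha> + w * \<beta> + w\<^sup>2 * \<gamma>"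
    and "z = \<alpha> + w\<^sup>2 * \<beta> + w * \<gamma>"
  have "x - y = (1 - w) * (\<beta> - w\<^sup>2 * \<gamma>) + (1 - w ^ 3) * \<gamma>"
    "x - z = (1 - w) * (\<gamma> - w\<^sup>2 * \<beta>) + (1 - w ^ 3) * \<beta>"
    "y - z = w * (1 - w) * (\<beta> - \<gamma>)"
    by (simp_all add: x_def y_def z_def algebra_simps power2_eq_square power3_eq_cube)
  then have "x - y = (1 - w) * (\<beta> - w\<^sup>2 * \<gamma>)" "x - z = (1 - w) * (\<gamma> - w\<^sup>2 * \<beta>)"
    "y - z = w * (1 - w) * (\<beta> - \<gamma>)"
    by (simp_all add: w3)
  moreover have "w \<noteq> 0"
    using w(2) by auto
  moreover have "(w\<^sup>2 * v) ^ 3 = v ^ 3" for v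
    using w3 power_mult[of w 2 3] power_mult[of w 3 2] by (simp add: power_mult_distrib)
  then have "\<beta> \<noteq> w\<^sup>2 * \<gamma>" "\<gamma> \<noteq> w\<^sup>2 * \<beta>" "\<beta> \<noteq> \<gamma>"
    using cubes by metis+
  ultimately have "x \<noteq> y" "x \<noteq> z" "y \<noteq> z"
    using w_ne_1 by auto
  moreover have "x + y + z = 3 * \<alpha> + (\<beta> + \<gamma>) * (w\<^sup>2 + w + 1)"
    by (simp add: x_def y_def z_def algebra_simps)
  then have "x + y + z = a"
    using three by (simp add: \<alpha>_def w(2))
  moreover have "x\<^sup>2 + y\<^sup>2 + z\<^sup>2 = 3 * \<alpha>\<^sup>2 + 2 * \<alpha> * (\<beta> + \<gamma>) * (w\<^sup>2 + w + 1)
      + (\<beta>\<^sup>2 + \<gamma>\<^sup>2) * (w\<^sup>2 + w * w ^ 3 + 1) + \<beta> * \<gamma> * (2 + 4 * w ^ 3)"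
    by (simp add: x_def y_def z_def algebra_simps power2_eq_square power3_eq_cube)
  then have "x\<^sup>2 + y\<^sup>2 + z\<^sup>2 = b"
    using six_c by (simp add: w3 w(2) prod_eq_c)
  moreover have "x \<in> F" "y \<in> F" "z \<in> F"
    unfolding x_def y_def z_def using \<alpha> \<beta> \<gamma> w by (auto intro!: closed_F)
  ultimately show ?thesis
    using that by blast
qed

text \<open>
  Of \<open>\<phi>\<close> and \<open>G\<close> only the additive structure matters, so the parabola is
  pulled back along \<open>\<phi>\<close>; additivity on the whole ambient group makes \<open>\<phi>\<close> compatible with the
  differences in the Sidon condition.
\<close>

lemma parabola_sidon_and_three_fold_basis:
  fixes \<phi> :: "'g::ab_group_add \<Rightarrow> 'k \<times> 'k"
  assumes two: "(2::'k) \<noteq> 0" and three: "(3::'k) \<noteq> 0"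
    and w: "w \<in> F" "w\<^sup>2 + w + 1 = 0"
    and card: "card F > 7"
    and add: "\<And>f g. \<phi> (f + g) = \<phi> f + \<phi> g"
    and bij: "bij_betw \<phi> G (F \<times> F)"
    and G_add: "\<And>f g. f \<in> G \<Longrightarrow> g \<in> G \<Longrightarrow> f + g \<in> G"
  defines "S \<equiv> {s \<in> G. snd (\<phi> s) = (fst (\<phi> s))\<^sup>2}"
  shows "sidon_in G S"
    and "\<forall>g\<in>G. \<exists>s\<^sub>1\<in>S. \<exists>s\<^sub>2\<in>S. \<exists>s\<^sub>3\<in>S.
       s\<^sub>1 \<noteq> s\<^sub>2 \<and> s\<^sub>1 \<noteq> s\<^sub>3 \<and> s\<^sub>2 \<noteq> s\<^sub>3 \<and> s\<^sub>1 + s\<^sub>2 + s\<^sub>3 = g"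
proof -
  have inj: "inj_on \<phi> G" and im: "\<phi> ` G = F \<times> F"
    using bij by (auto simp: bij_betw_def)
  have diff: "\<phi> (f - g) = \<phi> f - \<phi> g" for f g
    using add[of "f - g" g] by (simp add: algebra_simps)
  have \<phi>_S: "\<phi> s = (fst (\<phi> s), (fst (\<phi> s))\<^sup>2)" if "s \<in> S" for s
    using that by (auto simp: S_def prod_eq_iff)
  have S_eqI: "s = t" if "s \<in> S" "t \<in> S" "fst (\<phi> s) = fst (\<phi> t)" for s t
    using that inj \<phi>_S[of s] \<phi>_S[of t] by (auto simp: S_def inj_on_def prod_eq_iff)
  have sidon: "s = u \<and> t = v"
    if S: "s \<in> S" "t \<in> S" "u \<in> S" "v \<in> S" and eq: "s - t = u - v" and ne: "s - t \<noteq> 0" for s t u v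
  proof -
    \<comment> \<open>the second coordinates give \<open>(A - B) * (A + B) = (A - B) * (C + D)\<close>, and \<open>A - B\<close> cancels\<close>
    define A B C D where "A = fst (\<phi> s)" "B = fst (\<phi> t)" "C = fst (\<phi> u)" "D = fst (\<phi> v)"
    note defs = this
    have "\<phi> s - \<phi> t = \<phi> u - \<phi> v"
      using arg_cong[OF eq, of \<phi>] by (simp add: diff)
    then have "(A, A\<^sup>2) - (B, B\<^sup>2) = (C, C\<^sup>2) - (D, D\<^sup>2)"
      using \<phi>_S S unfolding defs by metis
    then have d1: "A - B = C - D" and d2: "A\<^sup>2 - B\<^sup>2 = C\<^sup>2 - D\<^sup>2"
      by simp_all
    have "A \<noteq> B"
      using S_eqI[of s t] S ne by (auto simp: defs)
    moreover have "(A - B) * (A + B) = (A - B) * (C + D)"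
    proof -
      have "(A - B) * (A + B) = A\<^sup>2 - B\<^sup>2"
        by (simp add: power2_eq_square algebra_simps)
      also have "\<dots> = (C - D) * (C + D)"
        unfolding d2 by (simp add: power2_eq_square algebra_simps)
      finally show ?thesis
        by (simp add: d1)
    qed
    ultimately have "A + B = C + D"
      by simp
    have "2 * A = (A - B) + (A + B)"
      by simp
    also have "\<dots> = 2 * C"
      unfolding d1 \<open>A + B = C + D\<close> by simp
    finally have "2 * A = 2 * C" .
    then have "A = C"
      using two by simp
    with d1 have "B = D"
      by simp
    show ?thesis
      using S S_eqI \<open>A = C\<close> \<open>B = D\<close> unfolding defs by blast
  qed
  show "sidon_in G S"
    unfolding sidon_in_def
  proof (intro conjI ballI impI)
    show "S \<subseteq> G"
      by (auto simp: S_def)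
    fix x :: 'g assume "x \<noteq> 0"
    show "\<exists>\<^sub>\<le>\<^sub>1 y. y \<in> S \<times> S \<and> x = fst y - snd y"
    proof (rule Uniq_I)
      fix y y' assume "y \<in> S \<times> S \<and> x = fst y - snd y" "y' \<in> S \<times> S \<and> x = fst y' - snd y'"
      then have "fst y = fst y' \<and> snd y = snd y'"
        using \<open>x \<noteq> 0\<close> by (intro sidon) auto
      then show "y = y'"
        by (simp add: prod_eq_iff)
    qed
  qed
  show "\<forall>g\<in>G. \<exists>s\<^sub>1\<in>S. \<exists>s\<^sub>2\<in>S. \<exists>s\<^sub>3\<in>S.
       s\<^sub>1 \<noteq> s\<^sub>2 \<and> s\<^sub>1 \<noteq> s\<^sub>3 \<and> s\<^sub>2 \<noteq> s\<^sub>3 \<and> s\<^sub>1 + s\<^sub>2 + s\<^sub>3 = g"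
  proof
    fix g assume g: "g \<in> G"
    then have "\<phi> g \<in> F \<times> F"
      using im by blast
    then have "fst (\<phi> g) \<in> F" "snd (\<phi> g) \<in> F"
      by (simp_all add: mem_Times_iff)
    then obtain x y z where xyz: "x \<in> F" "y \<in> F" "z \<in> F" "x \<noteq> y" "x \<noteq> z" "y \<noteq> z"
      "x + y + z = fst (\<phi> g)" "x\<^sup>2 + y\<^sup>2 + z\<^sup>2 = snd (\<phi> g)"
      by (rule exists_distinct_prescribed_sum_and_square_sum[OF two three w card])
    have "\<exists>s\<in>S. \<phi> s = (x, x\<^sup>2)" if "x \<in> F" for x
    proof -
      have "(x, x\<^sup>2) \<in> \<phi> ` G"
        using that im by (auto intro: power_F)
      then obtain s where "s \<in> G" "\<phi> s = (x, x\<^sup>2)"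
        by fastforce
      then show ?thesis
        by (intro bexI[of _ s]) (simp_all add: S_def)
    qed
    then obtain r s t where rst: "r \<in> S" "s \<in> S" "t \<in> S"
      "\<phi> r = (x, x\<^sup>2)" "\<phi> s = (y, y\<^sup>2)" "\<phi> t = (z, z\<^sup>2)"
      using xyz by metis
    have "\<phi> (r + s + t) = \<phi> g"
      using xyz rst by (simp add: add prod_eq_iff)
    then have "r + s + t = g"
      using inj rst g by (auto simp: S_def inj_on_def G_add)
    moreover have "r \<noteq> s" "r \<noteq> t" "s \<noteq> t"
      using xyz rst by auto
    ultimately show "\<exists>s\<^sub>1\<in>S. \<exists>s\<^sub>2\<in>S. \<exists>s\<^sub>3\<in>S.
       s\<^sub>1 \<noteq> s\<^sub>2 \<and> s\<^sub>1 \<noteq> s\<^sub>3 \<and> s\<^sub>2 \<noteq> s\<^sub>3 \<and> s\<^sub>1 + s\<^sub>2 + s\<^sub>3 = g"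
      using rst by blast
  qed
qed

end

section \<open>Finite fields inside an algebraically closed field\<close>

text \<open>
  Multiplication by a nonzero \<open>x\<close> permutes the nonzero elements, so comparing the products over
  them gives \<open>x ^ (CARD('a) - 1) = 1\<close>.
\<close>

lemma power_card_power_eq_self:
  fixes x :: "'a::{finite,field}"
  shows "x ^ (CARD('a) ^ m) = x"
proof (induction m)
  case (Suc m)
  have "x ^ CARD('a) = x"
  proof (cases "x = 0")
    case False
    have "bij_betw ((*) x) (- {0}) (- {0})"
      using False by (intro bij_betwI[of _ _ _ "\<lambda>y. y / x"]) auto
    then have "(\<Prod>y\<in>-{0}. x * y) = \<Prod>(-{0})"
      by (rule prod.reindex_bij_betw)
    then have "x ^ card (- {0 :: 'a}) = 1"
      by (simp add: prod.distrib)
    moreover have "CARD('a) = Suc (card (- {0 :: 'a}))"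
      by (simp add: card_Suc_Diff1 Compl_eq_Diff_UNIV)
    ultimately show ?thesis
      by simp
  qed simp
  with Suc show ?case
    by (simp add: power_mult)
qed simp

text \<open>
  Over an algebraically closed field the roots, counted with multiplicity, number \<open>degree p\<close>; a
  multiple root would be a root of the derivative as well.
\<close>

lemma card_roots_separable:
  fixes p :: "'k::alg_closed_field poly"
  assumes "p \<noteq> 0" and sep: "\<And>x. poly p x = 0 \<Longrightarrow> poly (pderiv p) x \<noteq> 0"
  shows "card {x. poly p x = 0} = degree p"
proof -
  obtain A where A: "size A = degree p" "p = smult (lead_coeff p) (\<Prod>x\<in>#A. [:- x, 1:])"
    using alg_closed_imp_factorization[OF \<open>p \<noteq> 0\<close>] by blast
  have roots: "set_mset A = {x. poly p x = 0}"
    using \<open>p \<noteq> 0\<close> by (subst A(2)) (auto simp: poly_prod_mset prod_mset_zero_iff)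
  have "A = mset_set (set_mset A)"
  proof (rule multiset_eqI)
    fix x
    have "count A x \<le> 1"
    proof (rule ccontr)
      assume "\<not> count A x \<le> 1"
      then have "\<exists>B. A = {#x, x#} + B"
        by (intro exI[of _ "A - {#x, x#}"] multiset_eqI) auto
      then obtain B where B: "A = {#x, x#} + B" ..
      define r where "r = smult (lead_coeff p) (\<Prod>x\<in>#B. [:- x, 1:])"
      have p: "p = [:- x, 1:] * ([:- x, 1:] * r)"
        by (subst A(2)) (simp only: B r_def, simp add: mult_smult_right)
      have "poly p x = 0" "poly (pderiv p) x = 0"
        unfolding p by (simp_all add: pderiv_mult del: mult_pCons_left)
      with sep show False
        by blast
    qed
    then show "count A x = count (mset_set (set_mset A)) x"
      by (cases "x \<in># A") (auto simp: not_in_iff intro!: antisym)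
  qed
  then have "size A = card (set_mset A)"
    by (metis size_mset_set)
  then show ?thesis
    using A(1) roots by simp
qed

text \<open>
  The fixed points of an iterate of the Frobenius endomorphism form a subfield. They are the roots
  of \<open>X ^ N - X\<close>, which is separable because its derivative is the constant \<open>-1\<close>.
\<close>

lemma finite_subfield_power_fixed_points:
  fixes N :: nat
  assumes char: "prime CHAR('k::alg_closed_field)" and N: "N = CHAR('k) ^ k" and "k > 0"
  shows "finite_subfield {x::'k. x ^ N = x}" and "card {x::'k. x ^ N = x} = N"
proof -
  have "N > 1"
    using char \<open>k > 0\<close> unfolding N by (intro one_less_power prime_gt_1_nat)
  define P where "P = monom 1 N + [:0, -1::'k:]"
  have "degree P = N"
    unfolding P_def using \<open>N > 1\<close>
    by (subst degree_add_eq_left) (auto simp: degree_monom_eq)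
  then have "P \<noteq> 0"
    using \<open>N > 1\<close> by auto
  have roots: "{x. poly P x = 0} = {x::'k. x ^ N = x}"
    by (auto simp: P_def poly_monom)
  have "of_nat N = (0::'k)"
    using \<open>k > 0\<close> by (simp add: N)
  then have "pderiv P = [:-1:]"
    by (simp add: P_def pderiv_add pderiv_monom pderiv_pCons)
  then show "card {x::'k. x ^ N = x} = N"
    using card_roots_separable[OF \<open>P \<noteq> 0\<close>] \<open>degree P = N\<close> by (simp add: roots)
  have add: "(x + y) ^ N = x ^ N + y ^ N" for x y :: 'k
    by (rule freshmans_dream'[OF char N])
  have diff: "(x - y) ^ N = x ^ N - y ^ N" for x y :: 'k
    using add[of "x - y" y] by (simp add: algebra_simps)
  show "finite_subfield {x::'k. x ^ N = x}"
    by unfold_locales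
      (use poly_roots_finite[OF \<open>P \<noteq> 0\<close>] in \<open>auto simp: roots diff power_mult_distrib power_inverse\<close>)
qed

section \<open>Coordinates over the ground field\<close>

lemma (in vector_space) card_span_independent:
  assumes "finite B" "independent B"
  shows "card (span B) = card (UNIV :: 'a set) ^ card B"
proof -
  let ?\<Phi> = "\<lambda>u. \<Sum>v\<in>B. scale (u v) v"
  have "inj_on ?\<Phi> (B \<rightarrow>\<^sub>E UNIV)"
  proof (rule inj_onI)
    fix u u' assume u: "u \<in> B \<rightarrow>\<^sub>E UNIV" "u' \<in> B \<rightarrow>\<^sub>E UNIV" and eq: "?\<Phi> u = ?\<Phi> u'"
    have "(\<Sum>v\<in>B. scale (u v - u' v) v) = 0"
      using eq by (simp add: scale_left_diff_distrib sum_subtractf)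
    then have "u v = u' v" if "v \<in> B" for v
      using independentD[OF assms(2,1) subset_refl, of "\<lambda>v. u v - u' v" v] that by simp
    with u show "u = u'"
      by (auto intro: PiE_ext)
  qed
  moreover have "?\<Phi> ` (B \<rightarrow>\<^sub>E UNIV) = span B"
  proof -
    have "?\<Phi> u \<in> ?\<Phi> ` (B \<rightarrow>\<^sub>E UNIV)" for u
      by (rule image_eqI[of _ _ "restrict u B"]) auto
    then show ?thesis
      unfolding span_finite[OF assms(1)] by blast
  qed
  ultimately have "bij_betw ?\<Phi> (B \<rightarrow>\<^sub>E UNIV) (span B)"
    by (simp add: bij_betw_def)
  then have "card (B \<rightarrow>\<^sub>E (UNIV :: 'a set)) = card (span B)"
    by (rule bij_betw_same_card)
  then show ?thesis
    using assms(1) by (simp add: card_PiE)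
qed

text \<open>
  The cardinality determines the dimension, so a basis of \<open>V\<close> can be listed as
  \<open>e 0, \<dots>, e (n - 1)\<close>. The coordinate families \<open>c\<close> are functions on all of \<open>nat\<close>, ready to be
  replaced by coefficient functions of polynomials.
\<close>

lemma (in vector_space) finite_subspace_coordinates:
  assumes "finite (UNIV :: 'a set)" "subspace V" "finite V" "card V = card (UNIV :: 'a set) ^ n"
  obtains e where "range (\<lambda>c. \<Sum>i<n. scale (c i) (e i)) = V"
    and "\<And>c i. (\<Sum>i<n. scale (c i) (e i)) = 0 \<Longrightarrow> i < n \<Longrightarrow> c i = 0"
proof -
  obtain B where B: "B \<subseteq> V" "independent B" "V \<subseteq> span B" "card B = dim V"
    by (rule basis_exists)
  have "finite B"
    using B(1) assms(3) by (rule finite_subset)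
  have span: "span B = V"
    using B(3) span_minimal[OF B(1) assms(2)] by (rule subset_antisym[rotated])
  have "card {0, 1 :: 'a} \<le> card (UNIV :: 'a set)"
    using assms(1) by (intro card_mono) auto
  then have "card (UNIV :: 'a set) > 1"
    by simp
  then have "card B = n"
    using card_span_independent[OF \<open>finite B\<close> B(2)] span assms(4) by simp
  then obtain e where e: "bij_betw e {..<n} B"
    using ex_bij_betw_nat_finite[OF \<open>finite B\<close>] by (auto simp: atLeast0LessThan)
  have reindex: "(\<Sum>i<n. scale (u (e i)) (e i)) = (\<Sum>v\<in>B. scale (u v) v)" for u
    by (rule sum.reindex_bij_betw[OF e])
  \<comment> \<open>a family indexed by \<open>{..<n}\<close> becomes one indexed by \<open>B\<close> by composing with the inverse of \<open>e\<close>\<close>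
  define d where "d = the_inv_into {..<n} e"
  have d: "d (e i) = i" if "i < n" for i
    unfolding d_def using e that by (intro the_inv_into_f_f) (auto simp: bij_betw_def)
  have reindex': "(\<Sum>i<n. scale (c i) (e i)) = (\<Sum>v\<in>B. scale (c (d v)) v)" for c
    unfolding reindex[of "\<lambda>v. c (d v)", symmetric] by (rule sum.cong) (auto simp: d)
  show ?thesis
  proof
    show "range (\<lambda>c. \<Sum>i<n. scale (c i) (e i)) = V"
    proof
      show "range (\<lambda>c. \<Sum>i<n. scale (c i) (e i)) \<subseteq> V"
        unfolding reindex' span[symmetric] span_finite[OF \<open>finite B\<close>] by auto
      show "V \<subseteq> range (\<lambda>c. \<Sum>i<n. scale (c i) (e i))"
        unfolding span[symmetric] span_finite[OF \<open>finite B\<close>] reindex[symmetric] by auto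
    qed
  next
    fix c i assume "(\<Sum>i<n. scale (c i) (e i)) = 0" "i < n"
    then show "c i = 0"
      using independentD[OF B(2) \<open>finite B\<close> subset_refl, of "\<lambda>v. c (d v)" "e i"] e d
      by (auto simp: reindex' bij_betw_def)
  qed
qed

lemma mem_poly_below_iff: "f \<in> poly_below n \<longleftrightarrow> (\<forall>i\<ge>n. coeff f i = 0)"
proof
  assume *: "\<forall>i\<ge>n. coeff f i = 0"
  have "f = 0 \<or> \<not> n \<le> degree f"
    using * leading_coeff_0_iff[of f] by blast
  then show "f \<in> poly_below n"
    by (auto simp: poly_below_def)
qed (auto simp: poly_below_def intro: coeff_eq_0)

lemma poly_below_coeffs_exist:
  obtains f where "f \<in> poly_below n" "\<And>i. i < n \<Longrightarrow> coeff f i = c i"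
proof
  let ?f = "\<Sum>i<n. monom (c i) i"
  have "coeff ?f j = (if j < n then c j else 0)" for j
    by (simp add: coeff_sum coeff_monom)
  then show "?f \<in> poly_below n" "\<And>i. i < n \<Longrightarrow> coeff ?f i = c i"
    by (simp_all add: mem_poly_below_iff)
qed

text \<open>
  The lower \<open>n\<close> and the upper \<open>n\<close> coefficients of a polynomial serve as the coordinates of the two
  components, with respect to the same basis of \<open>F\<close> over the ground field.
\<close>

lemma poly_below_additive_bij:
  fixes F :: "'a::{finite,field} alg_closure set"
  assumes F: "finite_subfield F" and card: "card F = CARD('a) ^ n"
    and to_ac: "range to_ac \<subseteq> F"
  obtains \<phi> :: "'a poly \<Rightarrow> 'a alg_closure \<times> 'a alg_closure"
  where "\<forall>f g. \<phi> (f + g) = \<phi> f + \<phi> g" "bij_betw \<phi> (poly_below (2 * n)) (F \<times> F)"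
proof -
  interpret F: finite_subfield F
    by (rule F)
  interpret vector_space "\<lambda>(c::'a) (x::'a alg_closure). to_ac c * x"
    by unfold_locales (simp_all add: algebra_simps)
  have "subspace F"
    unfolding subspace_def using to_ac by (auto intro!: F.closed_F)
  then obtain e where e: "range (\<lambda>c. \<Sum>i<n. to_ac (c i) * e i) = F"
    and indep: "\<And>c i. (\<Sum>i<n. to_ac (c i) * e i) = 0 \<Longrightarrow> i < n \<Longrightarrow> c i = 0"
    using finite_subspace_coordinates[OF _ _ F.finite_F card] by auto
  define \<phi> where "\<phi> f = (\<Sum>i<n. to_ac (coeff f i) * e i, \<Sum>i<n. to_ac (coeff f (n + i)) * e i)" for f
  have add: "\<phi> (f + g) = \<phi> f + \<phi> g" for f g
    by (simp add: \<phi>_def sum.distrib algebra_simps)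
  have diff: "\<phi> (f - g) = \<phi> f - \<phi> g" for f g
    using add[of "f - g" g] by (simp add: algebra_simps)
  have "bij_betw \<phi> (poly_below (2 * n)) (F \<times> F)"
    unfolding bij_betw_def
  proof
    show "inj_on \<phi> (poly_below (2 * n))"
    proof (rule inj_onI)
      fix f g assume fg: "f \<in> poly_below (2 * n)" "g \<in> poly_below (2 * n)" "\<phi> f = \<phi> g"
      have "\<phi> (f - g) = 0"
        using fg by (simp add: diff)
      then have "(\<Sum>i<n. to_ac (coeff (f - g) i) * e i) = 0"
        "(\<Sum>i<n. to_ac (coeff (f - g) (n + i)) * e i) = 0"
        unfolding \<phi>_def zero_prod_def prod.inject by blast+
      then have low: "coeff (f - g) i = 0" and high: "coeff (f - g) (n + i) = 0" if "i < n" for i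
        using indep[of "coeff (f - g)"] indep[of "\<lambda>i. coeff (f - g) (n + i)"] that by simp_all
      have "coeff (f - g) j = 0" for j
      proof -
        consider "j < n" | "n \<le> j" "j - n < n" | "2 * n \<le> j"
          by linarith
        then show ?thesis
          using low[of j] high[of "j - n"] fg(1,2) by cases (auto simp: mem_poly_below_iff)
      qed
      then show "f = g"
        by (simp add: poly_eq_iff)
    qed
  next
    show "\<phi> ` poly_below (2 * n) = F \<times> F"
    proof
      show "\<phi> ` poly_below (2 * n) \<subseteq> F \<times> F"
        using e by (auto simp: \<phi>_def)
      show "F \<times> F \<subseteq> \<phi> ` poly_below (2 * n)"
      proof clarify
        fix x y assume "x \<in> F" "y \<in> F"
        then obtain c c' where c: "x = (\<Sum>i<n. to_ac (c i) * e i)" "y = (\<Sum>i<n. to_ac (c' i) * e i)"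
          using e by blast
        obtain f where f: "f \<in> poly_below (2 * n)"
          "\<And>i. i < 2 * n \<Longrightarrow> coeff f i = (if i < n then c i else c' (i - n))"
          using poly_below_coeffs_exist[of "2 * n" "\<lambda>i. if i < n then c i else c' (i - n)"] by blast
        have "\<phi> f = (x, y)"
          by (simp add: \<phi>_def c f(2))
        with f(1) show "(x, y) \<in> \<phi> ` poly_below (2 * n)"
          by force
      qed
    qed
  qed
  with add show ?thesis
    using that by blast
qed

section \<open>Sidon bases of order three among polynomials of bounded degree\<close>

theorem theorem1p6:
  fixes p h q :: nat
  assumes "prime p" and "p > 3" and "h \<ge> 1" and "q = p ^ h"
    and "CARD('a::{finite,field}) = q"
  shows "\<exists>K. \<forall>M\<^sub>0\<ge>K. \<exists>S :: 'a poly set. sidon_in (poly_below (4 * M\<^sub>0)) S \<and>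
    (\<forall>g \<in> poly_below (4 * M\<^sub>0). \<exists>s\<^sub>1\<in>S. \<exists>s\<^sub>2\<in>S. \<exists>s\<^sub>3\<in>S.
       s\<^sub>1 \<noteq> s\<^sub>2 \<and> s\<^sub>1 \<noteq> s\<^sub>3 \<and> s\<^sub>2 \<noteq> s\<^sub>3 \<and> s\<^sub>1 + s\<^sub>2 + s\<^sub>3 = g)"
  \<comment> \<open>for \<open>M\<^sub>0 = 0\<close> the group is trivial and has no three distinct elements\<close>
proof (intro exI[of _ 1] allI impI)
  fix M\<^sub>0 :: nat assume "M\<^sub>0 \<ge> 1"
  have "prime CHAR('a)"
    using prime_CHAR_semidom[where ?'a = 'a] finite_imp_CHAR_pos[where ?'a = 'a] by simp
  moreover have "CHAR('a) dvd p ^ h"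
    using CHAR_dvd_CARD[where ?'a = 'a] assms by simp
  ultimately have CHAR: "CHAR('a) = p"
    using \<open>prime p\<close> by (simp add: prime_dvd_power primes_dvd_imp_eq)
  define N where "N = q ^ (2 * M\<^sub>0)"
  define F where "F = {x::'a alg_closure. x ^ N = x}"
  have N: "N = CHAR('a alg_closure) ^ (h * (2 * M\<^sub>0))"
    using assms by (simp add: N_def CHAR power_mult)
  have F: "finite_subfield F" and card_F: "card F = N"
    unfolding F_def
    by (rule finite_subfield_power_fixed_points[OF _ N]; use assms \<open>M\<^sub>0 \<ge> 1\<close> CHAR in simp)+
  have "x ^ N = x" for x :: 'a
    unfolding N_def assms(5)[symmetric] by (rule power_card_power_eq_self)
  then have to_ac: "range (to_ac :: 'a \<Rightarrow> _) \<subseteq> F"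
    by (auto simp: F_def simp flip: to_ac_power)
  have not_dvd: "\<not> p dvd 2" "\<not> p dvd 3"
    using \<open>p > 3\<close> by (auto dest: dvd_imp_le)
  have two: "(2::'a alg_closure) \<noteq> 0" and three: "(3::'a alg_closure) \<noteq> 0"
    using not_dvd of_nat_eq_0_iff_char_dvd[where ?'a = "'a alg_closure" and n = 2]
      of_nat_eq_0_iff_char_dvd[where ?'a = "'a alg_closure" and n = 3]
    by (simp_all add: CHAR)
  obtain w :: "'a alg_closure" where "poly [:1, 1, 1:] w = 0"
    using alg_closed_imp_poly_has_root[of "[:1, 1, 1 :: 'a alg_closure:]"] by auto
  then have w: "w\<^sup>2 + w + 1 = 0"
    by (simp add: power2_eq_square algebra_simps)
  have "prime (3 :: nat)"
    by simp
  then have "\<not> 3 dvd q"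
    using assms primes_dvd_imp_eq[of 3 p] prime_dvd_power[of 3 p h] by auto
  then have "q mod 3 = 1 \<or> q mod 3 = 2"
    by presburger
  then have "q\<^sup>2 mod 3 = 1"
    by (subst power_mod[symmetric]) auto
  then have "N mod 3 = 1"
    unfolding N_def power_mult by (subst power_mod[symmetric]) simp
  then obtain m where m: "N = 3 * m + 1"
    by (metis mult_div_mod_eq)
  have "w ^ 3 = 1"
    using w by (rule cube_eq_1_if_cyclotomic)
  then have "w \<in> F"
    by (simp add: F_def m power_mult)
  have "p \<le> q"
    using assms by (simp add: self_le_power)
  have "4 ^ 2 \<le> q ^ 2"
    using \<open>p \<le> q\<close> \<open>p > 3\<close> by (intro power_mono) auto
  also have "\<dots> \<le> q ^ (2 * M\<^sub>0)"
    using \<open>p \<le> q\<close> \<open>p > 3\<close> \<open>M\<^sub>0 \<ge> 1\<close> by (intro power_increasing) auto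
  finally have "16 \<le> q ^ (2 * M\<^sub>0)"
    by simp
  then have card: "card F > 7"
    by (simp add: card_F N_def)
  obtain \<phi> :: "'a poly \<Rightarrow> 'a alg_closure \<times> 'a alg_closure"
    where \<phi>: "\<forall>f g. \<phi> (f + g) = \<phi> f + \<phi> g" "bij_betw \<phi> (poly_below (2 * (2 * M\<^sub>0))) (F \<times> F)"
    by (rule poly_below_additive_bij[OF F card_F[unfolded N_def assms(5)[symmetric]] to_ac])
  have \<phi>_bij: "bij_betw \<phi> (poly_below (4 * M\<^sub>0)) (F \<times> F)"
    using \<phi>(2) by simp
  have "f + g \<in> poly_below (4 * M\<^sub>0)" if "f \<in> poly_below (4 * M\<^sub>0)" "g \<in> poly_below (4 * M\<^sub>0)"
    for f g :: "'a poly"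
    using that by (simp add: mem_poly_below_iff)
  from finite_subfield.parabola_sidon_and_three_fold_basis[OF F two three \<open>w \<in> F\<close> w card \<phi>(1)[rule_format] \<phi>_bij this]
  show "\<exists>S :: 'a poly set. sidon_in (poly_below (4 * M\<^sub>0)) S \<and>
    (\<forall>g \<in> poly_below (4 * M\<^sub>0). \<exists>s\<^sub>1\<in>S. \<exists>s\<^sub>2\<in>S. \<exists>s\<^sub>3\<in>S.
       s\<^sub>1 \<noteq> s\<^sub>2 \<and> s\<^sub>1 \<noteq> s\<^sub>3 \<and> s\<^sub>2 \<noteq> s\<^sub>3 \<and> s\<^sub>1 + s\<^sub>2 + s\<^sub>3 = g)"
    by blast
qed

end
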